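(* Let $(G,\beta)$ be an edge-labeled graph (in the setting described in the context) with vertices $v_1,\dots,v_n$, and let $(G',\beta|_{G'})$ be a subgraph of $(G,\beta)$ with the $n-1$ vertices $v_1,\dots,v_{n-1}$ (edge labels and vertex modules inherited from $G$). Then the map $\psi:\hat R_G\to\hat R_{G'}$ defined by $\psi(f_{v_1},\dots,f_{v_{n-1}},f_{v_n})=(f_{v_1},\dots,f_{v_{n-1}})$ is a well-defined $\mathbb{Z}$-module homomorphism whose kernel is $\hat{\mathcal F}_n\cup\{(0,\dots,0)\}$, the set of $n$-th flow-up classes of $\hat R_G$ together with the zero spline. In general, $\psi$ need not be surjective.
   Context: Setting: $G=(V,E)$ is a finite connected graph with vertices $v_1,\dots,v_n$. Each vertex $v$ is labeled by the $\mathbb{Z}$-module $M_v=m_v\mathbb{Z}$ ($m_v\in\mathbb{Z}$), and each edge $e=uv$ is labeled by $\beta(e)=M_e=\mathbb{Z}/r_e\mathbb{Z}$ ($r_e\in\mathbb{Z}$), with the quotient maps $\varphi_u:M_u\to M_e$, $a\mapsto a+r_e\mathbb{Z}$. A spline (extending generalized spline) is a tuple $f=(f_{v_1},\dots,f_{v_n})\in\prod_v M_v$ with $\varphi_u(f_u)=\varphi_v(f_v)$, i.e. $f_u-f_v\in r_e\mathbb{Z}$, for every edge $e=uv$. The set $\hat R_G$ of splines is a $\mathbb{Z}$-module under componentwise operations. An $i$-th flow-up class is a spline $F$ with $f_{v_i}\neq 0$ and $f_{v_s}=0$ for all $s<i$; $\hat{\mathcal F}_i$ denotes the set of $i$-th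 flow-up classes. *)

theory Defs
  imports
    "HOL-Algebra.IntRing"
    "Jordan_Normal_Form.Missing_VectorSpace"
    "Graph_Theory.Graph_Theory"
begin

text \<open>
  The vertex \<open>v\<^sub>i\<close> is the natural number \<open>i\<close>. Undirected simple graphs are
  \<^locale>\<open>pair_graph\<close>s: every edge \<open>uv\<close> occurs as the two arcs \<open>(u, v)\<close> and \<open>(v, u)\<close>.
  Edge labels are attached to the unordered pair \<open>{u, v}\<close>, so both arcs carry the same label.
  Only the values of \<open>m\<close> on vertices and of \<open>r\<close> on edges matter; a subgraph inherits its labels
  by using the same \<open>m\<close> and \<open>r\<close>.
\<close>

definition vertex_module :: "(nat \<Rightarrow> int) \<Rightarrow> nat \<Rightarrow> int set" where
  "vertex_module m v = PIdl\<^bsub>\<Z>\<^esub> (m v)"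

text \<open>The quotient map into \<open>M\<^sub>e = \<Z> / r\<^sub>e\<Z>\<close>, the ring \<^term>\<open>\<Z> Quot (PIdl\<^bsub>\<Z>\<^esub> (r e))\<close>.\<close>

definition edge_quotient_map :: "(nat set \<Rightarrow> int) \<Rightarrow> nat set \<Rightarrow> int \<Rightarrow> int set" where
  "edge_quotient_map r e a = PIdl\<^bsub>\<Z>\<^esub> (r e) +>\<^bsub>\<Z>\<^esub> a"

definition splines ::
  "nat pair_pre_digraph \<Rightarrow> (nat \<Rightarrow> int) \<Rightarrow> (nat set \<Rightarrow> int) \<Rightarrow> (nat \<Rightarrow> int) set" where
  "splines G m r =
     {f \<in> (\<Pi>\<^sub>E v \<in> pverts G. vertex_module m v).
        \<forall>(u, v) \<in> parcs G. edge_quotient_map r {u, v} (f u) = edge_quotient_map r {u, v} (f v)}"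

text \<open>Modules are records extending rings; the ring multiplication and unit play no role.\<close>

definition spline_module ::
  "nat pair_pre_digraph \<Rightarrow> (nat \<Rightarrow> int) \<Rightarrow> (nat set \<Rightarrow> int) \<Rightarrow> (int, nat \<Rightarrow> int) module" where
  "spline_module G m r =
     \<lparr>carrier = splines G m r, mult = undefined, one = undefined,
      zero = (\<lambda>v\<in>pverts G. 0),
      add = (\<lambda>f g. \<lambda>v\<in>pverts G. f v + g v),
      smult = (\<lambda>c f. \<lambda>v\<in>pverts G. c * f v)\<rparr>"

definition flow_up_classes ::
  "nat pair_pre_digraph \<Rightarrow> (nat \<Rightarrow> int) \<Rightarrow> (nat set \<Rightarrow> int) \<Rightarrow> nat \<Rightarrow> (nat \<Rightarrow> int) set" where
  "flow_up_classes G m r i =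
     {f \<in> splines G m r. f i \<noteq> 0 \<and> (\<forall>s \<in> pverts G. s < i \<longrightarrow> f s = 0)}"

definition drop_last_vertex :: "nat \<Rightarrow> (nat \<Rightarrow> int) \<Rightarrow> nat \<Rightarrow> int" where
  "drop_last_vertex n f = restrict f {1..n - 1}"

text \<open>\<open>G'\<close> is any subgraph on \<open>v\<^sub>1, \<dots>, v\<^sub>n\<^sub>-\<^sub>1\<close>, not necessarily induced or connected.
  (\<^const>\<open>connected\<close> includes nonemptiness, so \<open>n \<ge> 1\<close>.)\<close>

definition graph_with_subgraph ::
  "nat \<Rightarrow> nat pair_pre_digraph \<Rightarrow> nat pair_pre_digraph \<Rightarrow> bool" where
  "graph_with_subgraph n G G' \<longleftrightarrow>
     pair_graph G \<and> connected G \<and> pverts G = {1..n} \<and>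
     pair_graph G' \<and> subgraph G' G \<and> pverts G' = {1..n - 1}"

lemma vertex_module_iff: "a \<in> vertex_module m v \<longleftrightarrow> m v dvd a"
  by (auto simp: vertex_module_def cgenideal_def dvd_def mult.commute)

lemma edge_quotient_map_eq_iff:
  "edge_quotient_map r e a = edge_quotient_map r e b \<longleftrightarrow> r e dvd a - b"
proof -
  have mem: "x \<in> edge_quotient_map r e c \<longleftrightarrow> r e dvd x - c" for x c
    by (auto simp: edge_quotient_map_def a_r_coset_def' cgenideal_def dvd_def algebra_simps)
  show ?thesis
  proof
    assume "edge_quotient_map r e a = edge_quotient_map r e b"
    then show "r e dvd a - b" using mem[of a a] mem[of a b] by simp
  next
    assume d: "r e dvd a - b"
    have "r e dvd x - a \<longleftrightarrow> r e dvd x - b" for x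
      using dvd_add_left_iff[OF d, of "x - a"] by simp
    then show "edge_quotient_map r e a = edge_quotient_map r e b" using mem by blast
  qed
qed

end

theory Submission
  imports Defs
begin

text \<open>Being a spline is a system of divisibility conditions: \<open>m v\<close> divides
  \<open>f v\<close>, and \<open>r {u, v}\<close> divides \<open>f u - f v\<close> along each arc.
  These are linear, so splines form a module. Passing to a subgraph with inherited labels only
  discards conditions, so truncation preserves splines, and it is linear because operations are
  componentwise. A spline killed by truncation vanishes below \<open>n\<close>; it is a flow-up
  class or zero according to its value at \<open>n\<close> (\<open>drop_last_vertex_ker\<close>).
  Surjectivity fails when the edge to the dropped vertex constrains the other values
  (\<open>drop_last_vertex_not_surj\<close>).\<close>

lemma splines_iff:
  "f \<in> splines G m r \<longleftrightarrow>
     f \<in> extensional (pverts G) \<and> (\<forall>v \<in> pverts G. m v dvd f v) \<and>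
     (\<forall>(u, v) \<in> parcs G. r {u, v} dvd f u - f v)"
  by (auto simp: splines_def vertex_module_iff edge_quotient_map_eq_iff PiE_def)

lemma spline_eqI:
  assumes "f \<in> splines G m r" "g \<in> splines G m r" "\<And>v. v \<in> pverts G \<Longrightarrow> f v = g v"
  shows "f = g"
  using assms by (auto simp: splines_iff intro: extensionalityI)

lemma spline_outside: "f \<in> splines G m r \<Longrightarrow> v \<notin> pverts G \<Longrightarrow> f v = undefined"
  by (auto simp: splines_iff extensional_def)

lemma zero_in_splines:
  assumes "pair_wf_digraph G"
  shows "(\<lambda>v\<in>pverts G. 0) \<in> splines G m r"
  \<comment> \<open>Well-formedness puts both ends of an arc in \<open>pverts G\<close>, where
    \<open>restrict\<close> can be unfolded.\<close>
  using pair_wf_digraph.wellformed'[OF assms] by (auto simp: splines_iff)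

lemma add_in_splines:
  assumes "pair_wf_digraph G" "f \<in> splines G m r" "g \<in> splines G m r"
  shows "(\<lambda>v\<in>pverts G. f v + g v) \<in> splines G m r"
proof -
  have "r {u, v} dvd (f u + g u) - (f v + g v)" if "(u, v) \<in> parcs G" for u v
  proof -
    have "r {u, v} dvd (f u - f v) + (g u - g v)"
      using assms that by (intro dvd_add) (auto simp: splines_iff)
    then show ?thesis by (simp add: algebra_simps)
  qed
  then show ?thesis
    using assms pair_wf_digraph.wellformed'[OF assms(1)] by (auto simp: splines_iff)
qed

lemma scale_in_splines:
  assumes "pair_wf_digraph G" "f \<in> splines G m r"
  shows "(\<lambda>v\<in>pverts G. c * f v) \<in> splines G m r"
proof -
  have "r {u, v} dvd c * f u - c * f v" if "(u, v) \<in> parcs G" for u v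
    using assms that by (auto simp: splines_iff right_diff_distrib[symmetric])
  then show ?thesis
    using assms pair_wf_digraph.wellformed'[OF assms(1)] by (auto simp: splines_iff)
qed

lemma spline_module_simps [simp]:
  "carrier (spline_module G m r) = splines G m r"
  "\<zero>\<^bsub>spline_module G m r\<^esub> = (\<lambda>v\<in>pverts G. 0)"
  "f \<oplus>\<^bsub>spline_module G m r\<^esub> g = (\<lambda>v\<in>pverts G. f v + g v)"
  "c \<odot>\<^bsub>spline_module G m r\<^esub> f = (\<lambda>v\<in>pverts G. c * f v)"
  by (simp_all add: spline_module_def)

lemma module_spline_module:
  assumes G: "pair_wf_digraph G"
  shows "Module.module \<Z> (spline_module G m r)"
proof (rule Module.moduleI)
  show "abelian_group (spline_module G m r)"
  proof (rule abelian_groupI)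
    fix f assume f: "f \<in> carrier (spline_module G m r)"
    show "\<exists>g\<in>carrier (spline_module G m r).
            g \<oplus>\<^bsub>spline_module G m r\<^esub> f = \<zero>\<^bsub>spline_module G m r\<^esub>"
      using scale_in_splines[OF G, of f m r "-1"] f
      \<comment> \<open>The inverse is taken as the multiple by -1, so that closure under scaling
        makes it a spline.\<close>
      by (intro bexI[of _ "\<lambda>v\<in>pverts G. -1 * f v"]) (auto intro: restrict_ext)
  \<comment> \<open>The unit law is an equality of total functions; off \<open>pverts G\<close> both
    sides are \<open>undefined\<close> by \<open>spline_outside\<close>.\<close>
  qed (auto simp: zero_in_splines[OF G] add_in_splines[OF G] fun_eq_iff spline_outside add_ac)
qed (auto simp: int.cring_axioms scale_in_splines[OF G] fun_eq_iff spline_outside algebra_simps)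

text \<open>Arcs of \<open>G'\<close> are arcs of \<open>G\<close> with both ends in
  \<open>{1..n - 1}\<close>, where truncation changes no value.\<close>

lemma drop_last_vertex_in_splines:
  assumes "graph_with_subgraph n G G'" "f \<in> splines G m r"
  shows "drop_last_vertex n f \<in> splines G' m r"
proof -
  have "parcs G' \<subseteq> parcs G" "pair_wf_digraph G'"
    using assms(1) by (auto simp: graph_with_subgraph_def subgraph_def wf_digraph_wp_iff)
  then show ?thesis
    using assms pair_wf_digraph.wellformed'[of G']
    by (fastforce simp: splines_iff drop_last_vertex_def graph_with_subgraph_def)
qed

lemma mod_hom_drop_last_vertex:
  assumes "graph_with_subgraph n G G'"
  shows "mod_hom \<Z> (spline_module G m r) (spline_module G' m r) (drop_last_vertex n)"
proof (intro mod_hom.intro mod_hom_axioms.intro module_spline_module)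
  show "pair_wf_digraph G" "pair_wf_digraph G'"
    using assms by (auto simp: graph_with_subgraph_def subgraph_def wf_digraph_wp_iff)
  have "pverts G = {1..n}" "pverts G' = {1..n - 1}"
    using assms by (auto simp: graph_with_subgraph_def)
  then show "drop_last_vertex n \<in> LinearCombinations.module_hom \<Z> (spline_module G m r) (spline_module G' m r)"
    using drop_last_vertex_in_splines[OF assms]
    by (auto simp: LinearCombinations.module_hom_def drop_last_vertex_def intro!: restrict_ext)
qed

lemma drop_last_vertex_ker:
  assumes GG': "graph_with_subgraph n G G'"
  shows "mod_hom.ker (spline_module G m r) (spline_module G' m r) (drop_last_vertex n) =
           flow_up_classes G m r n \<union> {\<zero>\<^bsub>spline_module G m r\<^esub>}"
proof -
  have verts: "pverts G = {1..n}" "pverts G' = {1..n - 1}" and G: "pair_wf_digraph G"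
    using GG' by (auto simp: graph_with_subgraph_def subgraph_def wf_digraph_wp_iff)
  have zero: "(\<lambda>v\<in>{1..n}. 0) \<in> splines G m r"
    using zero_in_splines[OF G] verts by simp
  \<comment> \<open>This is the vanishing condition of \<open>flow_up_classes\<close>, so only the
    case split on \<open>f n = 0\<close> remains.\<close>
  have ker_iff: "drop_last_vertex n f = (\<lambda>v\<in>{1..n - 1}. 0) \<longleftrightarrow> (\<forall>s\<in>{1..n}. s < n \<longrightarrow> f s = 0)" for f
    by (auto simp: drop_last_vertex_def fun_eq_iff restrict_def)
  have "f = (\<lambda>v\<in>{1..n}. 0)"
    if "f \<in> splines G m r" "f n = 0" "\<forall>s\<in>{1..n}. s < n \<longrightarrow> f s = 0" for f
    by (rule spline_eqI[OF that(1) zero]) (use that verts in \<open>auto simp: le_less\<close>)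
  moreover have "(\<lambda>v\<in>{1..n}. 0) s = (0 :: int)" if "s \<in> {1..n}" for s
    using that by simp
  ultimately have "f \<in> splines G m r \<and> drop_last_vertex n f = (\<lambda>v\<in>{1..n - 1}. 0) \<longleftrightarrow>
                     f \<in> flow_up_classes G m r n \<union> {\<lambda>v\<in>{1..n}. 0}" for f
    unfolding ker_iff flow_up_classes_def verts using zero by blast
  then show ?thesis
    unfolding mod_hom.ker_def[OF mod_hom_drop_last_vertex[OF GG']] spline_module_simps verts
    by blast
qed

text \<open>
  On an edge \<open>v\<^sub>1v\<^sub>2\<close> with \<open>m\<^sub>1 = 1\<close>, \<open>m\<^sub>2 = 2\<close> and edge label \<open>2\<close>, the value at \<open>v\<^sub>1\<close> of every
  spline is even, so the spline \<open>1\<close> on the single vertex \<open>v\<^sub>1\<close> does not extend.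
\<close>

lemma drop_last_vertex_not_surj:
  "\<exists>n G G' m r. graph_with_subgraph n G G' \<and> connected G' \<and>
     drop_last_vertex n ` carrier (spline_module G m r) \<noteq> carrier (spline_module G' m r)"
proof -
  define G :: "nat pair_pre_digraph" where "G = \<lparr>pverts = {1, 2}, parcs = {(1, 2), (2, 1)}\<rparr>"
  \<comment> \<open>This is the subgraph of \<open>G\<close> induced on vertex 1, so the failure
    does not come from deleting further edges.\<close>
  define G' :: "nat pair_pre_digraph" where "G' = \<lparr>pverts = {1}, parcs = {}\<rparr>"
  define m :: "nat \<Rightarrow> int" where "m = (\<lambda>v. if v = 1 then 1 else 2)"
  define r :: "nat set \<Rightarrow> int" where "r = (\<lambda>e. 2)"
  define h :: "nat \<Rightarrow> int" where "h = (\<lambda>v\<in>{1}. 1)"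
  have pG: "pair_graph G"
    by unfold_locales (auto simp: G_def symmetric_def sym_def)
  have pG': "pair_graph G'"
    by unfold_locales (auto simp: G'_def symmetric_def sym_def)
  interpret G: pair_graph G by (rule pG)
  interpret G': pair_graph G' by (rule pG')
  have "strongly_connected (with_proj G)"
  proof (rule strongly_connectedI)
    fix u v assume "u \<in> verts (with_proj G)" "v \<in> verts (with_proj G)"
    then have "u \<in> pverts G \<and> u = v \<or> (u, v) \<in> parcs G" by (auto simp: G_def)
    then show "u \<rightarrow>\<^sup>*\<^bsub>with_proj G\<^esub> v" by auto
  qed (simp add: G_def)
  \<comment> \<open>\<open>connected\<close> means strong connectivity of the symmetrization, which
    adds nothing here.\<close>
  moreover have "mk_symmetric (with_proj G) = G"
    by (auto simp: mk_symmetric_def G_def)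
  ultimately have "connected G" by (simp add: connected_def)
  have "strongly_connected (with_proj G')"
    by (rule strongly_connectedI) (auto simp: G'_def reachable_def)
  moreover have "mk_symmetric (with_proj G') = G'"
    by (simp add: mk_symmetric_def G'_def)
  ultimately have cG': "connected G'" by (simp add: connected_def)
  have "subgraph G' G"
    using G.wf_digraph_axioms G'.wf_digraph_axioms
    by (auto simp: subgraph_def compatible_def G_def G'_def)
  then have gws: "graph_with_subgraph 2 G G'"
    using pG pG' \<open>connected G\<close> by (auto simp: graph_with_subgraph_def G_def G'_def)
  have "h \<in> splines G' m r"
    by (auto simp: splines_iff h_def G'_def m_def)
  moreover have "h \<notin> drop_last_vertex 2 ` splines G m r"
  proof
    assume "h \<in> drop_last_vertex 2 ` splines G m r"
    then obtain f where f: "f \<in> splines G m r" and h: "h = drop_last_vertex 2 f" by auto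
    have "f 1 = 1" using fun_cong[OF h, of 1] by (simp add: h_def drop_last_vertex_def)
    \<comment> \<open>The first parity comes from the edge label, the second from the module at
      vertex 2.\<close>
    moreover have "even (f 1 - f 2)" "even (f 2)"
      using f by (auto simp: splines_iff G_def m_def r_def)
    ultimately show False by simp
  qed
  ultimately show ?thesis
    using gws cG' by (intro exI[of _ 2] exI[of _ G] exI[of _ G'] exI[of _ m] exI[of _ r]) auto
qed

theorem theorem3p2:
  shows "(\<forall>n G G' m r. graph_with_subgraph n G G' \<longrightarrow>
            mod_hom \<Z> (spline_module G m r) (spline_module G' m r) (drop_last_vertex n) \<and>
            mod_hom.ker (spline_module G m r) (spline_module G' m r) (drop_last_vertex n) =
              flow_up_classes G m r n \<union> {\<zero>\<^bsub>spline_module G m r\<^esub>}) \<and>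
         (\<exists>n G G' m r. graph_with_subgraph n G G' \<and> connected G' \<and>
            drop_last_vertex n ` carrier (spline_module G m r) \<noteq> carrier (spline_module G' m r))"
  using mod_hom_drop_last_vertex drop_last_vertex_ker drop_last_vertex_not_surj by blast

end
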